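(* Let $n\ge1$, let $A(t)=\{a_{kl}(t)\}_{k,l=1}^n$ be a real matrix function continuous on $[0,\infty)$, and let $B(t,\tau)=\{b_{kl}(t,\tau)\}_{k,l=1}^n$ be a real matrix function continuous on $\{0\le\tau\le t<\infty\}$. Assume that for every $X_0\in\mathbb{R}^n$ the Cauchy problem $$\frac{dX(t)}{dt}=A(t)X(t)+\int_0^tB(t,\tau)X(\tau)\,d\tau,\quad t\in[0,\infty),\qquad X(0)=X_0,$$ has a unique solution. If $$\Lambda(A(t))+\int_0^t\|B(t,s)\|\,ds<0\qquad\text{for all } t\in[0,\infty),$$ then the trivial solution of the system $\frac{dX(t)}{dt}=A(t)X(t)+\int_0^tB(t,\tau)X(\tau)\,d\tau$ is stable.
   Context: Vectors in $\mathbb{R}^n$ carry the norm $\|X\|=\max_{1\le k\le n}|x_k|$, and $n\times n$ matrices carry the induced operator norm. The logarithmic norm of a matrix $A$ is $\Lambda(A)=\lim_{h\downarrow 0}(\|I+hA\|-1)/h$; for the max-norm this equals $\max_{1\le i\le n}\bigl(a_{ii}+\sum_{j\ne i}|a_{ij}|\bigr)$. Definition (stability). The trivial solution of the integro-differential system is stable if for every $\varepsilon>0$ there exists $\delta(\varepsilon)>0$ such that every solution $X$ with $\|X(0)\|\le\delta(\varepsilon)$ satisfies $\|X(t)\|\le\varepsilon$ for all $t\ge0$. *)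

theory Defs
  imports "HOL-Analysis.Analysis"
begin

text \<open>The norm on vectors is the max-norm, which is \<^const>\<open>infnorm\<close> in the library.\<close>

lemma infnorm_vec_eq_Max:
  fixes x :: "real ^ 'n"
  shows "infnorm x = Max (range (\<lambda>k. \<bar>x $ k\<bar>))"
  unfolding infnorm_cart by (subst cSup_eq_Max) (auto simp: full_SetCompr_eq)

text \<open>This follows the definition of \<^const>\<open>onorm\<close>, which is tied to the Euclidean norm of
  \<^typ>\<open>real ^ 'n\<close>. The vector \<open>x = 0\<close> contributes \<open>0 / 0 = 0\<close>, which
  does not affect the supremum.\<close>

definition mat_infnorm :: "real ^ 'n ^ 'n \<Rightarrow> real" where
  "mat_infnorm M = (SUP x. infnorm (M *v x) / infnorm x)"

definition log_norm :: "real ^ 'n ^ 'n \<Rightarrow> real" where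
  "log_norm M = Lim (at_right 0) (\<lambda>h::real. (mat_infnorm (mat 1 + h *\<^sub>R M) - 1) / h)"

text \<open>Solutions are total functions, but only their values on \<open>{0..}\<close> matter;
  the derivative at \<open>0\<close> is one-sided.\<close>

definition ide_solution ::
  "(real \<Rightarrow> real ^ 'n ^ 'n) \<Rightarrow> (real \<Rightarrow> real \<Rightarrow> real ^ 'n ^ 'n) \<Rightarrow> (real \<Rightarrow> real ^ 'n) \<Rightarrow> bool" where
  "ide_solution A B X \<longleftrightarrow>
    (\<forall>t\<ge>0. (X has_vector_derivative
        (A t *v X t + integral {0..t} (\<lambda>\<tau>. B t \<tau> *v X \<tau>))) (at t within {0..}))"

definition unique_cauchy_solution ::
  "(real \<Rightarrow> real ^ 'n ^ 'n) \<Rightarrow> (real \<Rightarrow> real \<Rightarrow> real ^ 'n ^ 'n) \<Rightarrow> real ^ 'n \<Rightarrow> bool" where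
  "unique_cauchy_solution A B X0 \<longleftrightarrow>
    (\<exists>X. ide_solution A B X \<and> X 0 = X0 \<and>
      (\<forall>Y. ide_solution A B Y \<and> Y 0 = X0 \<longrightarrow> (\<forall>t\<ge>0. Y t = X t)))"

definition trivial_solution_stable ::
  "(real \<Rightarrow> real ^ 'n ^ 'n) \<Rightarrow> (real \<Rightarrow> real \<Rightarrow> real ^ 'n ^ 'n) \<Rightarrow> bool" where
  "trivial_solution_stable A B \<longleftrightarrow>
    (\<forall>\<epsilon>>0. \<exists>\<delta>>0. \<forall>X. ide_solution A B X \<and> infnorm (X 0) \<le> \<delta> \<longrightarrow>
      (\<forall>t\<ge>0. infnorm (X t) \<le> \<epsilon>))"

end

theory Submission
  imports Defs
begin

text \<open>Suppose the max-norm of a solution reaches a level above its initial value, let \<open>T\<close> be the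
  first time this happens, and let \<open>i\<close> be a component realising the norm at \<open>T\<close>. The hypothesis
  makes \<open>sgn (X T $ i) * X t $ i\<close> strictly decreasing at \<open>T\<close>, so the norm was already larger
  shortly before \<open>T\<close>, which is a contradiction.\<close>

section \<open>The max-norm of vectors and its induced matrix norm\<close>

lemma abs_component_le_infnorm: "\<bar>x $ i\<bar> \<le> infnorm (x :: real ^ 'n)"
  unfolding infnorm_vec_eq_Max by (intro Max_ge) auto

lemma infnorm_attained:
  fixes x :: "real ^ 'n"
  obtains i where "infnorm x = \<bar>x $ i\<bar>"
proof -
  have "infnorm x \<in> range (\<lambda>k. \<bar>x $ k\<bar>)"
    unfolding infnorm_vec_eq_Max by (intro Max_in) auto
  with that show thesis by auto
qed

lemma infnorm_vec_leI:
  fixes x :: "real ^ 'n"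
  assumes "\<And>i. \<bar>x $ i\<bar> \<le> c"
  shows "infnorm x \<le> c"
  by (metis assms infnorm_attained)

lemma abs_matrix_vector_component_le:
  fixes M :: "real ^ 'n ^ 'n"
  shows "\<bar>(M *v x) $ i\<bar> \<le> (\<Sum>j\<in>UNIV. \<bar>M $ i $ j\<bar>) * infnorm x"
proof -
  have "\<bar>(M *v x) $ i\<bar> \<le> (\<Sum>j\<in>UNIV. \<bar>M $ i $ j * x $ j\<bar>)"
    unfolding matrix_vector_mult_def by simp
  also have "\<dots> \<le> (\<Sum>j\<in>UNIV. \<bar>M $ i $ j\<bar> * infnorm x)"
    by (intro sum_mono) (simp add: abs_mult mult_left_mono abs_component_le_infnorm)
  finally show ?thesis by (simp add: sum_distrib_right)
qed

text \<open>The triangle inequality in each row gives the upper bound; a sign vector of a maximal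
  row attains it, so the supremum is a maximum.\<close>

lemma mat_infnorm_eq_Max_row_sum:
  fixes M :: "real ^ 'n ^ 'n"
  shows "mat_infnorm M = Max (range (\<lambda>i. \<Sum>j\<in>UNIV. \<bar>M $ i $ j\<bar>))" (is "_ = Max (range ?r)")
proof -
  let ?R = "Max (range ?r)"
  have r_le: "?r i \<le> ?R" for i by (intro Max_ge) auto
  have "Max (range r) \<in> range r" for r :: "'n \<Rightarrow> real" by (intro Max_in) auto
  then obtain i where i: "?R = ?r i" by (meson imageE)
  \<comment> \<open>The zero vector contributes the quotient \<open>0 / 0 = 0\<close>, which is
    below \<open>?R\<close> only because \<open>?R\<close> is nonnegative.\<close>
  have R0: "0 \<le> ?R" using r_le[of i] by (rule order_trans[OF sum_nonneg, rotated]) simp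
  have le: "infnorm (M *v x) / infnorm x \<le> ?R" for x
  proof -
    have "infnorm (M *v x) \<le> ?R * infnorm x"
      by (intro infnorm_vec_leI order_trans[OF abs_matrix_vector_component_le]
          mult_right_mono r_le infnorm_pos_le)
    then show ?thesis
      using R0 infnorm_pos_le[of x] by (cases "infnorm x = 0") (auto simp: divide_simps)
  qed
  \<comment> \<open>Signs of row \<open>i\<close>, with 1 in place of \<open>sgn 0\<close>, so that
    every component has absolute value 1.\<close>
  define x :: "real ^ 'n" where "x = (\<chi> j. if M $ i $ j < 0 then - 1 else 1)"
  obtain k where "infnorm x = \<bar>x $ k\<bar>" by (rule infnorm_attained)
  then have "infnorm x = 1" by (simp add: x_def)
  moreover have "(M *v x) $ i = ?r i"
    unfolding matrix_vector_mult_def x_def by (auto intro!: sum.cong)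
  then have "?r i \<le> infnorm (M *v x)"
    using abs_component_le_infnorm[of "M *v x" i] by simp
  ultimately have "?R \<le> infnorm (M *v x) / infnorm x"
    unfolding i by simp
  with le[of x] have "?R = infnorm (M *v x) / infnorm x" by (rule antisym[rotated])
  then have "?R \<in> range (\<lambda>x. infnorm (M *v x) / infnorm x)"
    by (rule range_eqI)
  then show ?thesis
    unfolding mat_infnorm_def by (rule cSup_eq_maximum) (auto simp only: image_iff intro: le)
qed

lemma row_sum_le_mat_infnorm:
  fixes M :: "real ^ 'n ^ 'n"
  shows "(\<Sum>j\<in>UNIV. \<bar>M $ i $ j\<bar>) \<le> mat_infnorm M"
  unfolding mat_infnorm_eq_Max_row_sum by (intro Max_ge) auto

lemma continuous_on_Max_image:
  fixes f :: "'i \<Rightarrow> 'a::topological_space \<Rightarrow> 'b::linorder_topology"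
  assumes "finite I" "I \<noteq> {}" "\<And>i. i \<in> I \<Longrightarrow> continuous_on S (f i)"
  shows "continuous_on S (\<lambda>x. Max ((\<lambda>i. f i x) ` I))"
  using assms by (induction rule: finite_ne_induct) (auto intro!: continuous_on_max)

text \<open>The row-sum formula reduces this to a finite maximum of continuous functions. It
  supplies integrability of the norm of the kernel.\<close>

lemma continuous_on_mat_infnorm [continuous_intros]:
  fixes f :: "'a::topological_space \<Rightarrow> real ^ 'n ^ 'n"
  assumes "continuous_on S f"
  shows "continuous_on S (\<lambda>x. mat_infnorm (f x))"
  unfolding mat_infnorm_eq_Max_row_sum
  by (intro continuous_on_Max_image continuous_intros assms) auto

section \<open>The logarithmic norm\<close>

lemma log_norm_eq_Max:
  fixes M :: "real ^ 'n ^ 'n"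
  shows "log_norm M = Max (range (\<lambda>i. M $ i $ i + (\<Sum>j\<in>UNIV - {i}. \<bar>M $ i $ j\<bar>)))"
    (is "_ = Max (range ?l)")
proof -
  \<comment> \<open>For small \<open>h > 0\<close> the diagonal entries of
    \<open>mat 1 + h *\<^sub>R M\<close> are positive, so its row sums are affine in
    \<open>h\<close>. The difference quotient is then eventually constant, and the limit is that
    constant.\<close>
  have small: "eventually (\<lambda>h. 0 < h \<and> (\<forall>i. 0 < 1 + h * M $ i $ i)) (at_right (0::real))"
  proof -
    have "eventually (\<lambda>h. 0 < 1 + h * M $ i $ i) (at_right (0::real))" for i
    proof (rule order_tendstoD(1))
      show "((\<lambda>h. 1 + h * M $ i $ i) \<longlongrightarrow> 1 + 0 * M $ i $ i) (at_right (0::real))"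
        by (intro tendsto_intros)
    qed simp
    then show ?thesis
      by (intro eventually_conj eventually_all_finite) (auto simp: eventually_at_right_less)
  qed
  have "eventually (\<lambda>h. (mat_infnorm (mat 1 + h *\<^sub>R M) - 1) / h = Max (range ?l)) (at_right 0)"
    using small
  proof eventually_elim
    case (elim h)
    have "(\<Sum>j\<in>UNIV. \<bar>(mat 1 + h *\<^sub>R M) $ i $ j\<bar>) = 1 + h * ?l i" for i
    proof -
      have "(\<Sum>j\<in>UNIV. \<bar>(mat 1 + h *\<^sub>R M) $ i $ j\<bar>)
          = \<bar>1 + h * M $ i $ i\<bar> + (\<Sum>j\<in>UNIV - {i}. \<bar>h * M $ i $ j\<bar>)"
        by (subst sum.remove[of _ i]) (auto simp: mat_def intro!: sum.cong)
      also have "\<dots> = 1 + h * ?l i"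
        using elim by (simp add: abs_mult sum_distrib_left less_imp_le algebra_simps)
      finally show ?thesis .
    qed
    then have "mat_infnorm (mat 1 + h *\<^sub>R M) = Max ((\<lambda>y. 1 + h * y) ` range ?l)"
      unfolding mat_infnorm_eq_Max_row_sum by (simp add: image_image)
    also have "\<dots> = 1 + h * Max (range ?l)"
      using elim by (intro mono_Max_commute[symmetric]) (auto intro!: monoI)
    finally show ?case using elim by simp
  qed
  then have "((\<lambda>h. (mat_infnorm (mat 1 + h *\<^sub>R M) - 1) / h) \<longlongrightarrow> Max (range ?l)) (at_right 0)"
    by (rule tendsto_eventually)
  then show ?thesis
    unfolding log_norm_def by (intro tendsto_Lim) auto
qed

lemma row_le_log_norm:
  fixes M :: "real ^ 'n ^ 'n"
  shows "M $ i $ i + (\<Sum>j\<in>UNIV - {i}. \<bar>M $ i $ j\<bar>) \<le> log_norm M"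
  unfolding log_norm_eq_Max by (intro Max_ge) auto

text \<open>Since \<open>sgn (x $ i) * x $ i\<close> is the full norm, the diagonal entry keeps its
  sign; only the off-diagonal entries pass to absolute values. This is why
  \<open>log_norm M\<close>, which can be negative, appears instead of
  \<open>mat_infnorm M\<close>.\<close>

lemma sgn_mult_matrix_vector_le_log_norm:
  fixes M :: "real ^ 'n ^ 'n"
  assumes "infnorm x = \<bar>x $ i\<bar>"
  shows "sgn (x $ i) * (M *v x) $ i \<le> log_norm M * infnorm x"
proof -
  have "sgn (x $ i) * (M *v x) $ i
      = M $ i $ i * infnorm x + (\<Sum>j\<in>UNIV - {i}. sgn (x $ i) * (M $ i $ j * x $ j))"
    unfolding matrix_vector_mult_def assms
    by (simp add: sum.remove[of UNIV i] distrib_left sum_distrib_left abs_sgn mult.commute mult.left_commute)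
  also have "(\<Sum>j\<in>UNIV - {i}. sgn (x $ i) * (M $ i $ j * x $ j))
      \<le> (\<Sum>j\<in>UNIV - {i}. \<bar>M $ i $ j\<bar> * infnorm x)"
  proof (rule sum_mono)
    fix j
    have "sgn (x $ i) * (M $ i $ j * x $ j) \<le> \<bar>sgn (x $ i)\<bar> * (\<bar>M $ i $ j\<bar> * \<bar>x $ j\<bar>)"
      by (metis abs_ge_self abs_mult)
    also have "\<dots> \<le> 1 * (\<bar>M $ i $ j\<bar> * infnorm x)"
      by (intro mult_mono abs_component_le_infnorm) (auto simp: abs_sgn_eq)
    finally show "sgn (x $ i) * (M $ i $ j * x $ j) \<le> \<bar>M $ i $ j\<bar> * infnorm x" by simp
  qed
  also have "M $ i $ i * infnorm x + (\<Sum>j\<in>UNIV - {i}. \<bar>M $ i $ j\<bar> * infnorm x)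
      = (M $ i $ i + (\<Sum>j\<in>UNIV - {i}. \<bar>M $ i $ j\<bar>)) * infnorm x"
    by (simp add: sum_distrib_right distrib_right)
  also have "\<dots> \<le> log_norm M * infnorm x"
    by (intro mult_right_mono row_le_log_norm infnorm_pos_le)
  finally show ?thesis by simp
qed

section \<open>Estimates along a solution\<close>

lemma abs_integral_matrix_vector_component_le:
  fixes K :: "real \<Rightarrow> real ^ 'n ^ 'n"
  assumes K: "continuous_on {a..b} K" and X: "continuous_on {a..b} X"
    and bound: "\<And>s. s \<in> {a..b} \<Longrightarrow> infnorm (X s) \<le> c"
  shows "\<bar>integral {a..b} (\<lambda>s. K s *v X s) $ i\<bar> \<le> integral {a..b} (\<lambda>s. mat_infnorm (K s)) * c"
proof -
  have cont: "continuous_on {a..b} (\<lambda>s. K s *v X s)"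
    unfolding matrix_vector_mult_def by (intro continuous_intros K X)
  have "integral {a..b} (\<lambda>s. K s *v X s) $ i = integral {a..b} (\<lambda>s. (K s *v X s) $ i)"
    by (intro integral_component_eq_cart[symmetric] integrable_continuous_interval cont)
  also have "\<bar>\<dots>\<bar> \<le> integral {a..b} (\<lambda>s. mat_infnorm (K s) * c)"
    unfolding real_norm_def[symmetric]
  proof (rule integral_norm_bound_integral)
    fix s assume s: "s \<in> {a..b}"
    have "\<bar>(K s *v X s) $ i\<bar> \<le> (\<Sum>j\<in>UNIV. \<bar>K s $ i $ j\<bar>) * infnorm (X s)"
      by (rule abs_matrix_vector_component_le)
    also have "\<dots> \<le> mat_infnorm (K s) * c"
      by (intro mult_mono row_sum_le_mat_infnorm bound s infnorm_pos_le
          order_trans[OF sum_nonneg row_sum_le_mat_infnorm]) auto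
    finally show "norm ((K s *v X s) $ i) \<le> mat_infnorm (K s) * c" by simp
  qed (intro integrable_continuous_interval continuous_intros cont K)+
  finally show ?thesis by simp
qed

text \<open>The strict inequality at time 0 makes the first time at level \<open>c\<close> positive,
  which leaves room to its left for the contradiction.\<close>

lemma ide_solution_infnorm_less:
  fixes A :: "real \<Rightarrow> real ^ 'n ^ 'n"
  assumes B: "continuous_on {(t, \<tau>). 0 \<le> \<tau> \<and> \<tau> \<le> t} (\<lambda>(t, \<tau>). B t \<tau>)"
    and neg: "\<And>t. t \<ge> 0 \<Longrightarrow> log_norm (A t) + integral {0..t} (\<lambda>s. mat_infnorm (B t s)) < 0"
    and sol: "ide_solution A B X" and init: "infnorm (X 0) < c" and t: "0 \<le> t"
  shows "infnorm (X t) < c"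
proof (rule ccontr)
  assume "\<not> infnorm (X t) < c"
  then have t_ge: "c \<le> infnorm (X t)" by simp
  define X' where "X' s = A s *v X s + integral {0..s} (\<lambda>\<tau>. B s \<tau> *v X \<tau>)" for s
  have deriv: "(X has_vector_derivative X' s) (at s within {0..})" if "0 \<le> s" for s
    using sol that unfolding ide_solution_def X'_def by auto
  then have "continuous_on {0..} X"
    by (metis atLeast_iff continuous_on_eq_continuous_within has_vector_derivative_continuous)
  then have cont: "continuous_on {0..b} X" for b
    by (rule continuous_on_subset) auto
  \<comment> \<open>The times up to \<open>t\<close> at which the level \<open>c\<close> is reached.
    Being compact and nonempty, \<open>S\<close> has a least element, the first such time.\<close>
  define S where "S = {0..t} \<inter> (\<lambda>s. infnorm (X s)) -` {c..}"
  have "continuous_on {0..t} (\<lambda>s. infnorm (X s))"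
    using cont[of t] by (auto simp: continuous_on_def intro: tendsto_infnorm)
  then have "closed S"
    unfolding S_def by (intro continuous_closed_preimage) auto
  then have "compact S"
    by (metis S_def compact_eq_bounded_closed bounded_closed_interval bounded_Int)
  moreover have "t \<in> S" using t t_ge by (simp add: S_def)
  ultimately obtain T where T: "T \<in> S" and T_le: "\<And>s. s \<in> S \<Longrightarrow> T \<le> s"
    using compact_attains_inf[of S] by blast
  have before: "infnorm (X s) < c" if "0 \<le> s" "s < T" for s
    using T_le[of s] T that by (auto simp: S_def not_le[symmetric])
  have T_ge: "c \<le> infnorm (X T)" and T_pos: "0 < T"
    using T init by (cases "T = 0"; simp add: S_def)+
  \<comment> \<open>Positivity makes the derivative bound below strictly negative and excludes
    \<open>sgn (X T $ i) = 0\<close>.\<close>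
  have norm_pos: "0 < infnorm (X T)"
    using init T_ge infnorm_pos_le[of "X 0"] by linarith
  obtain i where i: "infnorm (X T) = \<bar>X T $ i\<bar>" by (rule infnorm_attained)
  \<comment> \<open>A differentiable stand-in for the norm: with the sign frozen at
    \<open>T\<close>, \<open>f\<close> equals the norm at \<open>T\<close> and lies below it at all
    other times.\<close>
  define f where "f s = sgn (X T $ i) * X s $ i" for s
  have f_le: "f s \<le> infnorm (X s)" for s
    using abs_component_le_infnorm[of "X s" i] by (auto simp: f_def sgn_if)
  have "continuous_on {0..T} (\<lambda>s. case (T, s) of (t, \<tau>) \<Rightarrow> B t \<tau>)"
    by (rule continuous_on_compose2[OF B]) (auto intro!: continuous_intros)
  then have B_T: "continuous_on {0..T} (B T)" by simp
  \<comment> \<open>As \<open>T\<close> is interior to the half-line, the derivative there is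
    two-sided, as \<open>DERIV_neg_dec_left\<close> requires.\<close>
  have "at T within {0..} = at T"
    using T_pos by (intro at_within_interior) simp
  then have "((\<lambda>s. X s $ i) has_vector_derivative X' T $ i) (at T)"
    using bounded_linear.has_vector_derivative[OF bounded_linear_vec_nth deriv[of T]] T_pos by simp
  then have "(f has_real_derivative sgn (X T $ i) * X' T $ i) (at T)"
    unfolding f_def has_real_derivative_iff_has_vector_derivative[symmetric]
    by (rule DERIV_cmult)
  moreover have "sgn (X T $ i) * X' T $ i < 0"
  proof -
    \<comment> \<open>Minimality of \<open>T\<close> bounds the whole history by the present norm,
      so the memory term can be compared with the logarithmic norm term.\<close>
    have "infnorm (X s) \<le> infnorm (X T)" if "s \<in> {0..T}" for s
      using before[of s] that T_ge by (cases "s = T") auto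
    then have "\<bar>integral {0..T} (\<lambda>s. B T s *v X s) $ i\<bar>
        \<le> integral {0..T} (\<lambda>s. mat_infnorm (B T s)) * infnorm (X T)"
      by (intro abs_integral_matrix_vector_component_le B_T cont)
    then have "sgn (X T $ i) * integral {0..T} (\<lambda>s. B T s *v X s) $ i
        \<le> integral {0..T} (\<lambda>s. mat_infnorm (B T s)) * infnorm (X T)"
      using norm_pos i by (auto simp: sgn_if)
    moreover have "sgn (X T $ i) * (A T *v X T) $ i \<le> log_norm (A T) * infnorm (X T)"
      by (rule sgn_mult_matrix_vector_le_log_norm[OF i])
    ultimately have "sgn (X T $ i) * X' T $ i
        \<le> (log_norm (A T) + integral {0..T} (\<lambda>s. mat_infnorm (B T s))) * infnorm (X T)"
      unfolding X'_def by (simp add: algebra_simps)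
    also have "\<dots> < 0"
      using neg[of T] T_pos norm_pos by (intro mult_neg_pos) auto
    finally show ?thesis .
  qed
  ultimately obtain d where d: "0 < d" "\<And>h. 0 < h \<Longrightarrow> h < d \<Longrightarrow> f T < f (T - h)"
    using DERIV_neg_dec_left by blast
  \<comment> \<open>Halving keeps \<open>h\<close> strictly below both \<open>d\<close> and
    \<open>T\<close>, so \<open>T - h\<close> is a positive time before \<open>T\<close>.\<close>
  define h where "h = min d T / 2"
  have h: "0 < h" "h < d" "h < T"
    using d T_pos by (auto simp: h_def min_def)
  have "infnorm (X T) = f T"
    using i by (simp add: f_def abs_sgn mult.commute)
  also have "\<dots> < f (T - h)" using d h by simp
  also have "\<dots> \<le> infnorm (X (T - h))" by (rule f_le)
  also have "\<dots> < c" using h by (intro before) auto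
  finally show False using T_ge by linarith
qed

theorem theorem3:
  fixes A :: "real \<Rightarrow> real ^ 'n ^ 'n"
    and B :: "real \<Rightarrow> real \<Rightarrow> real ^ 'n ^ 'n"
  assumes "continuous_on {0..} A"
    and "continuous_on {(t, \<tau>). 0 \<le> \<tau> \<and> \<tau> \<le> t} (\<lambda>(t, \<tau>). B t \<tau>)"
    and "\<forall>X0. unique_cauchy_solution A B X0"
    and "\<forall>t\<ge>0. log_norm (A t) + integral {0..t} (\<lambda>s. mat_infnorm (B t s)) < 0"
  shows "trivial_solution_stable A B"
  unfolding trivial_solution_stable_def
proof (intro allI impI)
  fix \<epsilon> :: real assume "\<epsilon> > 0"
  \<comment> \<open>The choice \<open>\<epsilon> / 2\<close> for \<open>\<delta>\<close> turns the
    non-strict initial bound into a strict one at level \<open>\<epsilon>\<close>.\<close>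
  have "infnorm (X t) \<le> \<epsilon>" if "ide_solution A B X" "infnorm (X 0) \<le> \<epsilon> / 2" "t \<ge> 0" for X t
  proof (rule less_imp_le, rule ide_solution_infnorm_less)
    show "infnorm (X 0) < \<epsilon>" using that(2) \<open>\<epsilon> > 0\<close> by linarith
    show "log_norm (A t) + integral {0..t} (\<lambda>s. mat_infnorm (B t s)) < 0" if "t \<ge> 0" for t
      using assms(4) that by blast
  qed (fact assms(2) that)+
  then show "\<exists>\<delta>>0. \<forall>X. ide_solution A B X \<and> infnorm (X 0) \<le> \<delta> \<longrightarrow> (\<forall>t\<ge>0. infnorm (X t) \<le> \<epsilon>)"
    using \<open>\<epsilon> > 0\<close> half_gt_zero by blast
qed

end
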